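(* For each integer $n\ge 0$ let $M_{n,0}$ be the (unique) finite multiset of integers with $\tilde h(M_{n,0})=\tilde e(n,0,0)$. Then for every $n\ge 0$ there exists a finite multiset $M_{n,1}\in R(2^{n+1}-1)$ with $\tilde e(n,0,1)=\tilde h(M_{n,1})$, and $$\tilde e(n+1,0,1)=L(\tilde h(M_{n,0}))\,\tilde h\big(M_{n,0}+S_{-1}(M_{n,0})\big)+2L(\tilde h(M_{n,0}))\,\tilde h(M_{n,0}+M_{n,1})+L(\tilde h(M_{n,1}))\,\tilde h(M_{n,0}+M_{n,0}),$$ where $L(\cdot)\,\tilde h(\cdot)$ denotes the left action of $\mathrm{CH}_2$.
   Context: Let $\mathrm{CH}_2$ be the commutative ring which is a free $\mathbb{Z}$-module with basis $\{h_i : i\ge 0\}$ and multiplication $h_ih_j=\sum_{k=0}^{\min(i,j)}h_{i+j-2k}$. Let $\tilde{\mathrm{CH}}_2$ be the free $\mathbb{Z}$-module with basis $\{\tilde h_i : i\in\mathbb{Z}\}$, with left $\mathrm{CH}_2$-action $h_i\tilde h_j=\sum_{k=0}^{i}\tilde h_{j-i+2k}$ ($i\ge0$), extended bilinearly. Let $L:\tilde{\mathrm{CH}}_2\to \mathrm{CH}_2$ be the $\mathbb{Z}$-linear map with $L(\tilde h_{-1})=0$, $L(\tilde h_i)=h_i$ for $i\ge 0$, $L(\tilde h_i)=-h_{-i-2}$ for $i\le -2$. The (associative, non-commutative) product on $\tilde{\mathrm{CH}}_2$ is $g_1g_2:=L(g_1)\,g_2$; powers $g^2=gg$. For $i\in\mathbb{Z}$,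 $S_i$ is the $\mathbb{Z}$-linear map with $S_i(\tilde h_j)=\tilde h_{j+i}$. Define $W_0(g_1,g_2,g_3)=g_2\big(g_1g_3-S_{-1}(g_1)S_{-1}(g_3)\big)$. Multisets: finite multisets of integers; $\mathrm{mult}(i,M)$ is the multiplicity of $i$; $\tilde h(M)=\sum_i\mathrm{mult}(i,M)\tilde h_i$; $M_1+M_2$ is the multiset $\{i_1+i_2:i_1\in M_1,i_2\in M_2\}$ with multiplicity, i.e. $\mathrm{mult}(i,M_1+M_2)=\sum_k\mathrm{mult}(i-k,M_1)\mathrm{mult}(k,M_2)$; $S_{i}(M)=M+\{i\}$; $\cup$ is multiset union. For integers $a\le b$, $a\equiv b\pmod 2$, $[a,b]=\{a,a+2,\dots,b\}$. For an integer $c$, $R(c)$ is the set of multisets of the form $\bigcup_{i=1}^{k_1}\{m_i\}\cup\bigcup_{i=1}^{k_2}[c-n_i,c+n_i]$ with integers $k_1,k_2\ge0$, $m_i\ge c$, $n_i\ge1$. Define $E_n:=\tilde e(n,0,0)$ by $E_0=\tilde h_2$ and $E_{n+1}=E_n\big(E_n^2-(S_{-1}E_n)^2\big)$. Define $F_n:=\tilde e(n,0,1)$ by $F_0=0$ and $F_{n+1}=W_0(E_n,E_n,F_n+S_{-1}E_n)+W_0(E_n,F_n,E_n)+W_0(F_n,E_n,E_n)$. *)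

theory Defs
  imports "HOL-Library.Multiset" "HOL-Library.Poly_Mapping"
begin

text \<open>Both free abelian groups are represented by finitely supported integer-valued functions, with
  \<^const>\<open>frag_extend\<close> as \<open>\<int>\<close>-linear extension from the basis. The ring product of
  \<open>CH\<^sub>2\<close> and the product of its tilde version are \<open>ch2_times\<close> and \<open>tch2_times\<close> below; the
  convolution product that the library puts on these types is a different operation and is
  never used here.\<close>

type_synonym ch2 = "nat \<Rightarrow>\<^sub>0 int"
type_synonym tch2 = "int \<Rightarrow>\<^sub>0 int"

abbreviation h :: "nat \<Rightarrow> ch2" where
  "h i \<equiv> frag_of i"

abbreviation th :: "int \<Rightarrow> tch2" where
  "th i \<equiv> frag_of i"

definition ch2_times :: "ch2 \<Rightarrow> ch2 \<Rightarrow> ch2" where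
  "ch2_times a b =
     frag_extend (\<lambda>i. frag_extend (\<lambda>j. \<Sum>k=0..min i j. h (i + j - 2 * k)) b) a"

definition act :: "ch2 \<Rightarrow> tch2 \<Rightarrow> tch2"  (infixr "\<cdot>" 70) where
  "a \<cdot> g = frag_extend (\<lambda>i. frag_extend (\<lambda>j. \<Sum>k=0..i. th (j - int i + 2 * int k)) g) a"

definition L :: "tch2 \<Rightarrow> ch2" where
  "L = frag_extend (\<lambda>i. if i = -1 then 0
                        else if i \<ge> 0 then h (nat i)
                        else - h (nat (- i - 2)))"

definition tch2_times :: "tch2 \<Rightarrow> tch2 \<Rightarrow> tch2"  (infixr "\<odot>" 70) where
  "g1 \<odot> g2 = L g1 \<cdot> g2"

definition S :: "int \<Rightarrow> tch2 \<Rightarrow> tch2" where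
  "S i = frag_extend (\<lambda>j. th (j + i))"

definition W0 :: "tch2 \<Rightarrow> tch2 \<Rightarrow> tch2 \<Rightarrow> tch2" where
  "W0 g1 g2 g3 = g2 \<odot> (g1 \<odot> g3 - S (-1) g1 \<odot> S (-1) g3)"

definition th_mset :: "int multiset \<Rightarrow> tch2" where
  "th_mset M = (\<Sum>i\<in>set_mset M. frag_cmul (int (count M i)) (th i))"

definition msumset :: "int multiset \<Rightarrow> int multiset \<Rightarrow> int multiset"  (infixl "\<oplus>" 65) where
  "M1 \<oplus> M2 = (\<Sum>i1\<in>#M1. {# i1 + i2. i2 \<in># M2 #})"

lemma count_msumset:
  "count (M1 \<oplus> M2) i = (\<Sum>k\<in>set_mset M2. count M1 (i - k) * count M2 k)"
proof (induction M1)
  case empty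
  then show ?case by (simp add: msumset_def)
next
  case (add x M1)
  have "count {# x + i2. i2 \<in># M2 #} i = count M2 (i - x)"
    by (induction M2) auto
  also have "\<dots> = (\<Sum>k\<in>set_mset M2. if k = i - x then count M2 k else 0)"
    by (simp add: not_in_iff)
  finally have "count (add_mset x M1 \<oplus> M2) i =
      (\<Sum>k\<in>set_mset M2. if k = i - x then count M2 k else 0) + count (M1 \<oplus> M2) i"
    by (simp add: msumset_def)
  also have "\<dots> = (\<Sum>k\<in>set_mset M2. count (add_mset x M1) (i - k) * count M2 k)"
    unfolding add.IH sum.distrib[symmetric] by (intro sum.cong) auto
  finally show ?case .
qed

definition S_mset :: "int \<Rightarrow> int multiset \<Rightarrow> int multiset" where
  "S_mset i M = M \<oplus> {#i#}"

text \<open>The interval \<open>[a,b] = {a, a+2, \<dots>, b}\<close>, used only for \<open>a \<le> b\<close> of equal parity.\<close>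

definition interval2 :: "int \<Rightarrow> int \<Rightarrow> int multiset" where
  "interval2 a b = mset_set {i. a \<le> i \<and> i \<le> b \<and> even (i - a)}"

text \<open>The union in the definition of \<open>R(c)\<close> adds multiplicities, hence multiset addition.\<close>

definition R :: "int \<Rightarrow> int multiset set" where
  "R c = {(\<Sum>i=1..k1. {# m i #}) + (\<Sum>i=1..k2. interval2 (c - n i) (c + n i)) |
            (k1::nat) (k2::nat) (m :: nat \<Rightarrow> int) (n :: nat \<Rightarrow> int).
            (\<forall>i\<in>{1..k1}. m i \<ge> c) \<and> (\<forall>i\<in>{1..k2}. n i \<ge> 1)}"

text \<open>\<open>e00 n\<close> and \<open>e01 n\<close> stand for \<open>e(n,0,0)\<close> and \<open>e(n,0,1)\<close> (with a tilde over the \<open>e\<close>).\<close>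

primrec e00 :: "nat \<Rightarrow> tch2" where
  "e00 0 = th 2"
| "e00 (Suc n) = e00 n \<odot> (e00 n \<odot> e00 n - S (-1) (e00 n) \<odot> S (-1) (e00 n))"

primrec e01 :: "nat \<Rightarrow> tch2" where
  "e01 0 = 0"
| "e01 (Suc n) = W0 (e00 n) (e00 n) (e01 n + S (-1) (e00 n))
               + W0 (e00 n) (e01 n) (e00 n)
               + W0 (e01 n) (e00 n) (e00 n)"

definition M0 :: "nat \<Rightarrow> int multiset" where
  "M0 n = (THE M. th_mset M = e00 n)"

end

theory Submission
  imports Defs
begin

text \<open>Identify the tilde module with the Laurent polynomials \<open>\<int>[x, 1/x]\<close> by sending the basis
  vector with index \<open>j\<close> to \<open>x\<^sup>j\<close>; the ring structure is then the convolution product of the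
  library. The element \<open>h\<^sub>i\<close> acts as multiplication by the character
  \<open>chi i = x\<^sup>-\<^sup>i + x\<^sup>2\<^sup>-\<^sup>i + \<dots> + x\<^sup>i\<close>, and \<open>g1 \<odot> g3 - S (-1) g1 \<odot> S (-1) g3\<close> collapses to the
  Laurent product \<open>g1 * g3\<close>. So \<open>W0 g1 g2 g3\<close> is \<open>g1 * g3\<close> multiplied by the character of
  \<open>L g2\<close>, which gives the recursion.

  The multisets in \<open>R c\<close> correspond to \<open>x\<^sup>c p\<close> with \<open>p\<close> in the cone spanned by the \<open>x\<^sup>m\<close> with
  \<open>m \<ge> 0\<close> and the characters. This cone is closed under products, and for \<open>c \<ge> 0\<close> it contains
  the character of \<open>L (x\<^sup>c p)\<close> whenever it contains \<open>p\<close>. Hence the recursions preserve the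
  property that \<open>e00 n\<close> lies in \<open>R (2^(n+1))\<close> and \<open>e01 n\<close> in \<open>R (2^(n+1) - 1)\<close>.\<close>

subsection \<open>Characters\<close>

definition chi :: "nat \<Rightarrow> tch2" where
  "chi i = (\<Sum>k=0..i. th (2 * int k - int i))"

text \<open>The Laurent polynomial by which \<open>g\<close> acts as the left factor of
  \<open>\<odot>\<close>.\<close>

definition Lchi :: "tch2 \<Rightarrow> tch2" where
  "Lchi g = frag_extend chi (L g)"

lemma th_mult: "th a * th b = th (a + b)"
  by (simp add: mult_single)

lemma chi_0 [simp]: "chi 0 = 1"
  by (simp add: chi_def)

lemma chi_Suc: "chi (Suc n) = th (int n + 1) + th (-1) * chi n"
  by (simp add: chi_def sum_distrib_left th_mult algebra_simps)

text \<open>Weyl character formula for SL(2) with the denominator cleared. Laurent polynomials over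
  the integers form an integral domain, so later identities are checked after multiplying by this
  factor.\<close>

lemma chi_telescope: "(th 1 - th (-1)) * chi n = th (int n + 1) - th (- int n - 1)"
proof (induction n)
  case 0
  then show ?case by simp
next
  case (Suc n)
  have "(th 1 - th (-1)) * chi (Suc n)
      = (th 1 - th (-1)) * th (int n + 1) + th (-1) * ((th 1 - th (-1)) * chi n)"
    by (simp add: chi_Suc algebra_simps)
  also have "\<dots> = th (int (Suc n) + 1) - th (- int (Suc n) - 1)"
    unfolding Suc.IH by (simp add: right_diff_distrib left_diff_distrib th_mult algebra_simps)
  finally show ?case .
qed

lemma th_1_neq: "th 1 - th (-1) \<noteq> 0"
  by (simp add: frag_of_eq)

section \<open>The action, \<open>\<odot>\<close> and \<open>L\<close> through Laurent
  products\<close>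

lemma frag_extend_mult_right: "frag_extend (\<lambda>i. f i * g) a = frag_extend f a * g"
  by (induction a rule: frag_induction[OF subset_UNIV])
    (simp_all add: frag_extend_diff left_diff_distrib)

lemma frag_extend_th_mult: "frag_extend (\<lambda>j. f * th j) g = f * g"
  by (induction g rule: frag_induction[OF subset_UNIV])
    (simp_all add: frag_extend_diff right_diff_distrib)

lemma act_eq_mult: "a \<cdot> g = frag_extend chi a * g"
proof -
  have "(\<Sum>k=0..i. th (j - int i + 2 * int k)) = chi i * th j" for i j
    unfolding chi_def sum_distrib_right th_mult by (simp add: algebra_simps)
  then show ?thesis
    by (simp add: act_def frag_extend_th_mult frag_extend_mult_right)
qed

lemma tch2_times_eq: "g1 \<odot> g2 = Lchi g1 * g2"
  by (simp add: tch2_times_def act_eq_mult Lchi_def)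

lemma S_eq_mult: "S i g = th i * g"
  using frag_extend_th_mult[of "th i" g] by (simp add: S_def th_mult add.commute)

lemma Lchi_0 [simp]: "Lchi 0 = 0"
  by (simp add: Lchi_def L_def)

lemma Lchi_add: "Lchi (a + b) = Lchi a + Lchi b"
  by (simp add: Lchi_def L_def frag_extend_add)

lemma Lchi_diff: "Lchi (a - b) = Lchi a - Lchi b"
  by (simp add: Lchi_def L_def frag_extend_diff)

lemma Lchi_sum: "finite I \<Longrightarrow> Lchi (\<Sum>i\<in>I. f i) = (\<Sum>i\<in>I. Lchi (f i))"
  by (induction I rule: finite_induct) (simp_all add: Lchi_add)

lemma Lchi_th_of_nat: "Lchi (th (int m)) = chi m"
  by (simp add: Lchi_def L_def)

text \<open>The three cases of \<open>L\<close> merge into one formula: the right side vanishes at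
  \<open>a = -1\<close> and changes sign under \<open>a\<close> to \<open>- a - 2\<close>.\<close>

lemma Lchi_th_telescope: "(th 1 - th (-1)) * Lchi (th a) = th (a + 1) - th (- a - 1)"
proof -
  consider "a = -1" | m where "a = int m" | m where "a = - int m - 2"
  proof -
    have "a = -1 \<or> a = int (nat a) \<or> a = - int (nat (- a - 2)) - 2" by linarith
    then show ?thesis using that by blast
  qed
  then show ?thesis
  proof cases
    case 1
    then show ?thesis by (simp add: Lchi_def L_def)
  next
    case 2
    then show ?thesis by (simp add: Lchi_th_of_nat chi_telescope)
  next
    case (3 m)
    have "Lchi (th a) = - chi m"
      using 3 by (simp add: Lchi_def L_def frag_extend_minus)
    then have "(th 1 - th (-1)) * Lchi (th a) = - ((th 1 - th (-1)) * chi m)"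
      by simp
    moreover have "a + 1 = - int m - 1" "- a - 1 = int m + 1"
      using 3 by simp_all
    ultimately show ?thesis
      by (simp only: chi_telescope minus_diff_eq)
  qed
qed

text \<open>On a monomial, telescoping both terms makes the two copies of
  \<open>th (- a - 1)\<close> cancel, leaving \<open>th (a + 1) - th (a - 1)\<close>.\<close>

lemma Lchi_diff_shift: "Lchi g - th (-1) * Lchi (th (-1) * g) = g"
proof (induction g rule: frag_induction[OF subset_UNIV])
  case 1
  then show ?case by simp
next
  case (2 a)
  have "(th 1 - th (-1)) * (Lchi (th a) - th (-1) * Lchi (th (a - 1)))
      = (th 1 - th (-1)) * Lchi (th a) - th (-1) * ((th 1 - th (-1)) * Lchi (th (a - 1)))"
    by (simp add: algebra_simps)
  also have "\<dots> = (th 1 - th (-1)) * th a"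
    unfolding Lchi_th_telescope
    by (simp add: right_diff_distrib left_diff_distrib th_mult add.commute, simp add: frag_of_eq)
  finally show ?case
    using th_1_neq by (simp add: th_mult add.commute[of "-1"])
next
  case (3 a b)
  then show ?case by (simp add: Lchi_diff algebra_simps)
qed

lemma W0_eq: "W0 g1 g2 g3 = Lchi g2 * (g1 * g3)"
proof -
  have "Lchi g1 * g3 - Lchi (th (-1) * g1) * (th (-1) * g3)
      = (Lchi g1 - th (-1) * Lchi (th (-1) * g1)) * g3"
    by (simp add: algebra_simps)
  then show ?thesis
    by (simp add: W0_def tch2_times_eq S_eq_mult Lchi_diff_shift)
qed

lemma chi_rev: "chi n = (\<Sum>k=0..n. th (int n - 2 * int k))"
  unfolding chi_def by (subst sum.atLeastAtMost_rev) (simp add: of_nat_diff algebra_simps)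

text \<open>Since \<open>chi n\<close> is invariant under inverting \<open>x\<close>, it factors out
  of both telescoped terms.\<close>

lemma Lchi_th_mult_chi: "Lchi (th c * chi n) = Lchi (th c) * chi n"
proof -
  have "(th 1 - th (-1)) * Lchi (th c * chi n)
      = (\<Sum>k=0..n. (th 1 - th (-1)) * Lchi (th (c + (2 * int k - int n))))"
    by (simp add: chi_def sum_distrib_left Lchi_sum th_mult)
  also have "\<dots> = th (c + 1) * (\<Sum>k=0..n. th (2 * int k - int n))
      - th (- c - 1) * (\<Sum>k=0..n. th (int n - 2 * int k))"
    unfolding Lchi_th_telescope
    by (simp add: sum_distrib_left th_mult sum_subtractf algebra_simps)
  also have "\<dots> = (th (c + 1) - th (- c - 1)) * chi n"
    by (simp add: chi_rev[symmetric] chi_def[symmetric] left_diff_distrib)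
  also have "\<dots> = (th 1 - th (-1)) * (Lchi (th c) * chi n)"
    by (simp add: Lchi_th_telescope[symmetric] mult.assoc)
  finally show ?thesis
    using th_1_neq by simp
qed

subsection \<open>The cone of monomials and characters\<close>

inductive_set cone :: "tch2 set" where
  zero: "0 \<in> cone"
| th: "p \<in> cone \<Longrightarrow> th (int m) + p \<in> cone"
| chi: "p \<in> cone \<Longrightarrow> chi n + p \<in> cone"

lemma th_in_cone: "th (int m) \<in> cone"
  using cone.th[OF cone.zero] by simp

lemma chi_in_cone: "chi n \<in> cone"
  using cone.chi[OF cone.zero] by simp

lemma cone_add: "p \<in> cone \<Longrightarrow> q \<in> cone \<Longrightarrow> p + q \<in> cone"
  by (induction p rule: cone.induct) (auto simp: add.assoc intro: cone.intros)

text \<open>Splitting off the top monomial lowers both the shift and the character by one, until one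
  of them is 0.\<close>

lemma th_mult_chi_in_cone: "th (int a) * chi b \<in> cone"
proof (induction b arbitrary: a)
  case 0
  then show ?case using th_in_cone by simp
next
  case (Suc b)
  show ?case
  proof (cases a)
    case 0
    then show ?thesis using chi_in_cone by simp
  next
    case (Suc a')
    have "th (int a) * chi (Suc b) = th (int (a + b + 1)) + th (int a') * chi b"
      unfolding Suc chi_Suc distrib_left mult.assoc[symmetric] th_mult by (simp add: algebra_simps)
    then show ?thesis using cone.th[OF Suc.IH] by (simp only:)
  qed
qed

text \<open>One step of the Clebsch-Gordan rule, verified after multiplying by the square of the
  telescoping factor.\<close>

lemma chi_mult_chi: "chi (Suc a) * chi (Suc b) = chi (a + b + 2) + chi a * chi b"
proof -
  let ?D = "th 1 - th (-1)"
  have "?D * (?D * (chi (Suc a) * chi (Suc b))) = (?D * chi (Suc a)) * (?D * chi (Suc b))"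
    by (simp only: ac_simps)
  also have "\<dots> = ?D * (?D * chi (a + b + 2)) + (?D * chi a) * (?D * chi b)"
    unfolding chi_telescope
    by (simp add: right_diff_distrib left_diff_distrib th_mult algebra_simps)
  also have "\<dots> = ?D * (?D * (chi (a + b + 2) + chi a * chi b))"
    by (simp only: distrib_left ac_simps)
  finally show ?thesis using th_1_neq by simp
qed

lemma chi_mult_chi_in_cone: "chi a * chi b \<in> cone"
proof (induction b arbitrary: a)
  case 0
  then show ?case using chi_in_cone by simp
next
  case (Suc b)
  show ?case
    by (cases a) (simp_all add: chi_in_cone chi_mult_chi cone.chi Suc.IH del: add_2_eq_Suc')
qed

lemma cone_mult:
  assumes "p \<in> cone" "q \<in> cone"
  shows "p * q \<in> cone"
  using assms(1)
proof induction
  case zero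
  then show ?case by (simp add: cone.zero)
next
  case (th p m)
  have "th (int m) * q \<in> cone"
    using assms(2)
  proof induction
    case (th q m')
    then show ?case
      using th_in_cone[of "m + m'"] by (simp add: distrib_left th_mult cone_add)
  qed (simp_all add: cone.zero distrib_left cone_add th_mult_chi_in_cone)
  with th show ?case by (simp add: distrib_right cone_add)
next
  case (chi p n)
  have "chi n * q \<in> cone"
    using assms(2)
  proof induction
    case (th q m)
    then show ?case
      using th_mult_chi_in_cone[of m n] by (simp add: distrib_left cone_add mult.commute)
  qed (simp_all add: cone.zero distrib_left cone_add chi_mult_chi_in_cone)
  with chi show ?case by (simp add: distrib_right cone_add)
qed

text \<open>As \<open>c\<close> is nonnegative, only the positive branch of \<open>L\<close> occurs:
  monomials become characters, and shifted characters become products of two characters.\<close>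

lemma Lchi_in_cone:
  assumes "p \<in> cone"
  shows "Lchi (th (int c) * p) \<in> cone"
  using assms
proof induction
  case zero
  then show ?case by (simp add: cone.zero)
next
  case (th p m)
  have "Lchi (th (int c) * th (int m)) = chi (c + m)"
    by (simp add: th_mult Lchi_th_of_nat flip: of_nat_add)
  with th show ?case by (simp add: distrib_left Lchi_add cone.chi)
next
  case (chi p n)
  then show ?case
    by (simp add: distrib_left Lchi_add Lchi_th_mult_chi Lchi_th_of_nat cone_add chi_mult_chi_in_cone)
qed

subsection \<open>Multisets\<close>

lemma lookup_th_mset: "Poly_Mapping.lookup (th_mset M) i = int (count M i)"
proof -
  have "Poly_Mapping.lookup (th_mset M) i = (\<Sum>j\<in>set_mset M. if j = i then int (count M j) else 0)"
    unfolding th_mset_def lookup_sum by (intro sum.cong) (auto simp: lookup_single when_def)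
  then show ?thesis by (simp add: not_in_iff)
qed

lemma th_mset_inj: "th_mset M = th_mset N \<Longrightarrow> M = N"
  by (rule multiset_eqI) (metis lookup_th_mset of_nat_eq_iff)

lemma th_mset_empty [simp]: "th_mset {#} = 0"
  by (simp add: th_mset_def)

lemma th_mset_add: "th_mset (M + N) = th_mset M + th_mset N"
  by (rule poly_mapping_eqI) (simp add: lookup_th_mset lookup_add)

lemma th_mset_single: "th_mset {#i#} = th i"
  by (simp add: th_mset_def)

lemma th_mset_add_mset: "th_mset (add_mset i M) = th i + th_mset M"
  using th_mset_add[of "{#i#}" M] by (simp add: th_mset_single)

lemma th_mset_msumset: "th_mset (M \<oplus> N) = th_mset M * th_mset N"
proof (induction M)
  case empty
  then show ?case by (simp add: msumset_def)
next
  case (add i M)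
  have "th_mset {# i + j. j \<in># N #} = th i * th_mset N"
    by (induction N) (simp_all add: th_mset_add_mset distrib_left th_mult)
  moreover have "add_mset i M \<oplus> N = {# i + j. j \<in># N #} + (M \<oplus> N)"
    by (simp add: msumset_def)
  ultimately show ?case
    by (simp add: add.IH th_mset_add th_mset_add_mset distrib_right)
qed

lemma th_mset_S_mset: "th_mset (S_mset i M) = th i * th_mset M"
  by (simp add: S_mset_def th_mset_msumset th_mset_single mult.commute)

lemma th_mset_mset_set: "finite A \<Longrightarrow> th_mset (mset_set A) = (\<Sum>i\<in>A. th i)"
  by (induction A rule: finite_induct) (simp_all add: th_mset_add_mset)

lemma th_mset_interval2: "th_mset (interval2 (c - int n) (c + int n)) = th c * chi n"
proof -
  let ?f = "\<lambda>k. c - int n + 2 * int k"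
  \<comment> \<open>Reindexing by \<open>k\<close> turns the interval into the summation range of
    \<open>chi n\<close>.\<close>
  have "{i. c - int n \<le> i \<and> i \<le> c + int n \<and> even (i - (c - int n))} = ?f ` {0..n}"
  proof (intro equalityI subsetI)
    fix i assume "i \<in> {i. c - int n \<le> i \<and> i \<le> c + int n \<and> even (i - (c - int n))}"
    then have i: "c - int n \<le> i" "i \<le> c + int n" "even (i - (c - int n))" by auto
    then obtain l where l: "i - (c - int n) = 2 * l" by (blast elim: evenE)
    with i have "i = ?f (nat l)" "nat l \<in> {0..n}" by auto
    then show "i \<in> ?f ` {0..n}" by blast
  qed auto
  moreover have "inj_on ?f {0..n}" by (auto simp: inj_on_def)
  ultimately show ?thesis
    by (simp add: interval2_def th_mset_mset_set sum.reindex chi_def sum_distrib_left th_mult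
        algebra_simps)
qed

section \<open>Realising shifted cone elements as multisets in \<open>R c\<close>\<close>

lemma empty_in_R: "{#} \<in> R c"
  unfolding R_def by (rule CollectI, rule exI[of _ 0], rule exI[of _ 0]) simp

lemma add_single_in_R:
  assumes "M \<in> R c" "m0 \<ge> c"
  shows "{#m0#} + M \<in> R c"
proof -
  from assms(1) obtain k1 k2 :: nat and m n where M:
    "M = (\<Sum>i=1..k1. {# m i #}) + (\<Sum>i=1..k2. interval2 (c - n i) (c + n i))"
    "\<forall>i\<in>{1..k1}. m i \<ge> c" "\<forall>i\<in>{1..k2}. n i \<ge> 1"
    unfolding R_def by blast
  let ?m = "m(Suc k1 := m0)"
  have "(\<Sum>i=1..Suc k1. {# ?m i #}) = {#m0#} + (\<Sum>i=1..k1. {# m i #})"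
    by simp
  then have "{#m0#} + M = (\<Sum>i=1..Suc k1. {# ?m i #}) + (\<Sum>i=1..k2. interval2 (c - n i) (c + n i))"
    by (simp only: M(1) add.assoc)
  moreover have "\<forall>i\<in>{1..Suc k1}. ?m i \<ge> c" using M(2) assms(2) by auto
  ultimately show ?thesis
    unfolding R_def using M(3) by blast
qed

lemma add_interval2_in_R:
  assumes "M \<in> R c" "n0 \<ge> 1"
  shows "interval2 (c - n0) (c + n0) + M \<in> R c"
proof -
  from assms(1) obtain k1 k2 :: nat and m n where M:
    "M = (\<Sum>i=1..k1. {# m i #}) + (\<Sum>i=1..k2. interval2 (c - n i) (c + n i))"
    "\<forall>i\<in>{1..k1}. m i \<ge> c" "\<forall>i\<in>{1..k2}. n i \<ge> 1"
    unfolding R_def by blast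
  let ?n = "n(Suc k2 := n0)"
  have "(\<Sum>i=1..Suc k2. interval2 (c - ?n i) (c + ?n i))
      = interval2 (c - n0) (c + n0) + (\<Sum>i=1..k2. interval2 (c - n i) (c + n i))"
    by simp
  then have "interval2 (c - n0) (c + n0) + M
      = (\<Sum>i=1..k1. {# m i #}) + (\<Sum>i=1..Suc k2. interval2 (c - ?n i) (c + ?n i))"
    by (simp only: M(1) ac_simps)
  moreover have "\<forall>i\<in>{1..Suc k2}. ?n i \<ge> 1" using M(3) assms(2) by auto
  ultimately show ?thesis
    unfolding R_def using M(2) by blast
qed

lemma cone_imp_R:
  assumes "p \<in> cone"
  shows "\<exists>M\<in>R c. th_mset M = th c * p"
  using assms
proof induction
  case zero
  then show ?case using empty_in_R[of c] by (intro bexI[of _ "{#}"]) simp_all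
next
  case (th p m)
  then obtain M where M: "M \<in> R c" "th_mset M = th c * p" by blast
  then show ?case
    using add_single_in_R[OF M(1), of "c + int m"]
    by (intro bexI[of _ "{#c + int m#} + M"])
      (simp_all add: th_mset_add_mset distrib_left th_mult)
next
  case (chi p n)
  then obtain M where M: "M \<in> R c" "th_mset M = th c * p" by blast
  show ?case
  \<comment> \<open>\<open>R c\<close> asks for intervals with radius at least 1, so
    \<open>chi 0 = 1\<close> has to enter as the singleton \<open>c\<close>.\<close>
  proof (cases "n = 0")
    case True
    then show ?thesis
      using M add_single_in_R[OF M(1), of c]
      by (intro bexI[of _ "{#c#} + M"]) (simp_all add: th_mset_add_mset distrib_left)
  next
    case False
    then show ?thesis
      using M add_interval2_in_R[OF M(1), of "int n"]
      by (intro bexI[of _ "interval2 (c - int n) (c + int n) + M"])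
        (simp_all add: th_mset_add th_mset_interval2 distrib_left)
  qed
qed

subsection \<open>The recursions\<close>

lemma e00_Suc: "e00 (Suc n) = Lchi (e00 n) * (e00 n * e00 n)"
proof -
  have "e00 (Suc n) = W0 (e00 n) (e00 n) (e00 n)" by (simp add: W0_def)
  then show ?thesis by (simp only: W0_eq)
qed

lemma e01_Suc: "e01 (Suc n) = Lchi (e00 n) * (e00 n * (th (-1) * e00 n))
    + 2 * (Lchi (e00 n) * (e00 n * e01 n)) + Lchi (e01 n) * (e00 n * e00 n)"
  by (simp add: W0_eq S_eq_mult algebra_simps)

text \<open>The two factors \<open>e00 n\<close> double the shift, while \<open>Lchi (e00 n)\<close>
  lies in the cone without any shift.\<close>

lemma e00_in_cone: "\<exists>p\<in>cone. e00 n = th (int (2 ^ (n + 1))) * p"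
proof (induction n)
  case 0
  then show ?case
    using th_in_cone[of 0] by (intro bexI[of _ 1]) simp_all
next
  case (Suc n)
  then obtain p where p: "p \<in> cone" "e00 n = th (int (2 ^ (n + 1))) * p" by blast
  have "e00 (Suc n) = th (int (2 ^ (n + 1))) * th (int (2 ^ (n + 1))) * (Lchi (e00 n) * (p * p))"
    unfolding e00_Suc by (subst (2 3) p(2)) (simp only: ac_simps)
  moreover have "th (int (2 ^ (n + 1))) * th (int (2 ^ (n + 1))) = th (int (2 ^ (Suc n + 1)))"
    by (simp add: th_mult)
  moreover have "Lchi (e00 n) * (p * p) \<in> cone"
    unfolding p(2) by (intro cone_mult Lchi_in_cone p)
  ultimately show ?case by (metis (no_types))
qed

lemma e01_in_cone: "\<exists>q\<in>cone. e01 n = th (int (2 ^ (n + 1) - 1)) * q"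
proof (induction n)
  case 0
  then show ?case
    by (intro bexI[of _ 0]) (simp_all add: cone.zero)
next
  case (Suc n)
  define c :: nat where "c = 2 ^ (n + 1) - 1"
  have c: "int (2 ^ (n + 1)) = int c + 1" "int (2 ^ (Suc n + 1) - 1) = 2 * int c + 1"
    by (simp_all add: c_def of_nat_diff)
  from Suc obtain q where q: "q \<in> cone" "e01 n = th (int c) * q"
    unfolding c_def by blast
  obtain p where p: "p \<in> cone" "e00 n = th (int c + 1) * p"
    using e00_in_cone[of n] unfolding c by blast
  \<comment> \<open>The cofactor of the shift \<open>2 * int c + 1\<close>. The first two terms of
    the recursion have exactly this shift; the last has \<open>2 * int c + 2\<close>, and its
    surplus goes into the cone as \<open>th (int 1)\<close>.\<close>
  let ?r = "Lchi (e00 n) * (p * p) + (Lchi (e00 n) * (p * q) + Lchi (e00 n) * (p * q))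
    + Lchi (e01 n) * (th (int 1) * (p * p))"
  have Lp: "Lchi (e00 n) \<in> cone"
    using Lchi_in_cone[OF p(1), of "c + 1"] by (simp add: p(2) add.commute)
  have Lq: "Lchi (e01 n) \<in> cone"
    unfolding q(2) by (intro Lchi_in_cone q)
  have "?r \<in> cone"
    by (intro cone_add cone_mult Lp Lq p q th_in_cone)
  moreover have "e01 (Suc n) = th (2 * int c + 1) * ?r"
  proof -
    have 1: "e00 n * (th (-1) * e00 n) = th (2 * int c + 1) * (p * p)"
    proof -
      have "e00 n * (th (-1) * e00 n) = th (int c + 1) * th (-1) * th (int c + 1) * (p * p)"
        unfolding p(2) by (simp only: ac_simps)
      then show ?thesis by (simp add: th_mult)
    qed
    have 2: "e00 n * e01 n = th (2 * int c + 1) * (p * q)"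
    proof -
      have "e00 n * e01 n = th (int c + 1) * th (int c) * (p * q)"
        unfolding p(2) q(2) by (simp only: ac_simps)
      then show ?thesis by (simp add: th_mult)
    qed
    have 3: "e00 n * e00 n = th (2 * int c + 1) * (th (int 1) * (p * p))"
    proof -
      have "e00 n * e00 n = th (int c + 1) * th (int c + 1) * (p * p)"
        unfolding p(2) by (simp only: ac_simps)
      then show ?thesis by (simp add: th_mult mult.assoc[symmetric] frag_of_eq)
    qed
    show ?thesis
      unfolding e01_Suc 1 2 3 mult_2 by (simp only: distrib_left ac_simps)
  qed
  ultimately show ?case
    unfolding c by blast
qed

lemma frag_cmul_2: "frag_cmul 2 x = 2 * (x :: tch2)"
  using frag_cmul_distrib[of 1 1 x] by (simp only: one_add_one frag_cmul_one mult_2)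

theorem theorem4:
  fixes n :: nat
  shows "(\<exists>!M. th_mset M = e00 n) \<and>
    (\<exists>M1 \<in> R (2 ^ (n + 1) - 1).
       e01 n = th_mset M1 \<and>
       e01 (n + 1) =
         L (th_mset (M0 n)) \<cdot> th_mset (M0 n \<oplus> S_mset (-1) (M0 n))
         + frag_cmul 2 (L (th_mset (M0 n)) \<cdot> th_mset (M0 n \<oplus> M1))
         + L (th_mset M1) \<cdot> th_mset (M0 n \<oplus> M0 n))"
proof -
  obtain M where M: "th_mset M = e00 n"
    using e00_in_cone[of n] cone_imp_R by metis
  then have ex1: "\<exists>!M. th_mset M = e00 n"
    using th_mset_inj by metis
  then have M0: "th_mset (M0 n) = e00 n"
    unfolding M0_def by (rule theI')
  \<comment> \<open>Left a natural-number subtraction, right an integer one; nothing is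
    truncated.\<close>
  have "int (2 ^ (n + 1) - 1) = 2 ^ (n + 1) - 1"
    by (simp add: of_nat_diff)
  then obtain M1 where M1: "M1 \<in> R (2 ^ (n + 1) - 1)" "th_mset M1 = e01 n"
    using e01_in_cone[of n] cone_imp_R by metis
  have "e01 (n + 1) =
         L (th_mset (M0 n)) \<cdot> th_mset (M0 n \<oplus> S_mset (-1) (M0 n))
         + frag_cmul 2 (L (th_mset (M0 n)) \<cdot> th_mset (M0 n \<oplus> M1))
         + L (th_mset M1) \<cdot> th_mset (M0 n \<oplus> M0 n)"
    \<comment> \<open>Sumsets, shifts and actions all become Laurent products, which leaves the
      recursion \<open>e01_Suc\<close>.\<close>
    unfolding frag_cmul_2 act_eq_mult Lchi_def[symmetric] th_mset_msumset th_mset_S_mset M0 M1(2)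
      Suc_eq_plus1[symmetric] by (rule e01_Suc)
  then show ?thesis
    using ex1 M1 by (metis (no_types, lifting))
qed

end
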